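(* Let $n\ge 2$ and let a group $G$ act on the set $\{1,\dots,n\}$. If the action is not isotypical, then the fixed point space $|\Pi_n|^G$ is contractible.
   Context: $\Pi_n$ is the poset of partitions of $\{1,\dots,n\}$ other than the one-block partition and the partition into singletons, ordered by refinement; $|\Pi_n|$ is the geometric realization of its order complex. An action of $G$ on $\{1,\dots,n\}$ induces an action on $\Pi_n$ and on $|\Pi_n|$, and $|\Pi_n|^G=|\Pi_n^G|$, where $\Pi_n^G$ is the subposet of $G$-invariant partitions. An action of $G$ on $\{1,\dots,n\}$ is called isotypical if all the $G$-orbits are pairwise isomorphic as $G$-sets. *)

theory Defs
  imports "HOL-Analysis.Analysis" "HOL-Algebra.Group_Action"
begin

definition proper_partitions :: "'a set \<Rightarrow> 'a set set set" where
  "proper_partitions A = {P. partition_on A P \<and> P \<noteq> {A} \<and> P \<noteq> (\<lambda>x. {x}) ` A}"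

definition order_complex :: "('v \<Rightarrow> 'v \<Rightarrow> bool) \<Rightarrow> 'v set \<Rightarrow> 'v set set" where
  "order_complex r V =
     {C. C \<subseteq> V \<and> finite C \<and> C \<noteq> {} \<and> Complete_Partial_Order.chain r C}"

text \<open>
  Points of the realization of an abstract simplicial complex \<open>K\<close> with vertex set \<open>V\<close> are given
  by their barycentric coordinates.  The definition is meant for finite \<open>V\<close>: then \<open>V \<rightarrow> \<real>\<close> with
  the product topology is a Euclidean space and the subspace topology is the usual one.  (For
  infinite \<open>V\<close> one would need finitely supported sums and the coherent topology instead.)
\<close>

definition realization_points :: "'v set \<Rightarrow> 'v set set \<Rightarrow> ('v \<Rightarrow> real) set" where
  "realization_points V K =
     {t \<in> extensional V. (\<forall>v\<in>V. 0 \<le> t v) \<and> (\<Sum>v\<in>V. t v) = 1 \<and> {v \<in> V. t v \<noteq> 0} \<in> K}"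

definition geometric_realization :: "'v set \<Rightarrow> 'v set set \<Rightarrow> ('v \<Rightarrow> real) topology" where
  "geometric_realization V K = subtopology (powertop_real V) (realization_points V K)"

definition partition_complex :: "nat \<Rightarrow> (nat set set \<Rightarrow> real) topology" where
  "partition_complex n =
     geometric_realization (proper_partitions {1..n})
       (order_complex (refines {1..n}) (proper_partitions {1..n}))"

definition partition_action :: "('g \<Rightarrow> 'a \<Rightarrow> 'a) \<Rightarrow> 'g \<Rightarrow> 'a set set \<Rightarrow> 'a set set" where
  "partition_action \<phi> g P = (\<lambda>B. \<phi> g ` B) ` P"

text \<open>
  An action \<open>\<psi>\<close> on the vertices is extended affinely over the simplices, so \<open>g\<close> sends
  \<open>\<Sum>v. t v * v\<close> to \<open>\<Sum>v. t v * \<psi> g v\<close>, whose coordinate at \<open>v\<close> is \<open>t (\<psi> (inv g) v)\<close>.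
\<close>

definition realization_action ::
    "('g, 'm) monoid_scheme \<Rightarrow> 'v set \<Rightarrow> ('g \<Rightarrow> 'v \<Rightarrow> 'v) \<Rightarrow> 'g \<Rightarrow> ('v \<Rightarrow> real) \<Rightarrow> ('v \<Rightarrow> real)" where
  "realization_action G V \<psi> g t = (\<lambda>v\<in>V. t (\<psi> (inv\<^bsub>G\<^esub> g) v))"

definition fixed_point_space ::
    "('g, 'm) monoid_scheme \<Rightarrow> 'x topology \<Rightarrow> ('g \<Rightarrow> 'x \<Rightarrow> 'x) \<Rightarrow> 'x topology" where
  "fixed_point_space G X \<psi> = subtopology X {x \<in> topspace X. \<forall>g\<in>carrier G. \<psi> g x = x}"

definition partition_complex_fixed_points ::
    "('g, 'm) monoid_scheme \<Rightarrow> nat \<Rightarrow> ('g \<Rightarrow> nat \<Rightarrow> nat) \<Rightarrow> (nat set set \<Rightarrow> real) topology" where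
  "partition_complex_fixed_points G n \<phi> =
     fixed_point_space G (partition_complex n)
       (realization_action G (proper_partitions {1..n}) (partition_action \<phi>))"

definition isomorphic_orbits ::
    "('g, 'm) monoid_scheme \<Rightarrow> ('g \<Rightarrow> 'a \<Rightarrow> 'a) \<Rightarrow> 'a set \<Rightarrow> 'a set \<Rightarrow> bool" where
  "isomorphic_orbits G \<phi> X Y \<longleftrightarrow>
     (\<exists>f. bij_betw f X Y \<and> (\<forall>g\<in>carrier G. \<forall>x\<in>X. f (\<phi> g x) = \<phi> g (f x)))"

definition isotypical :: "('g, 'm) monoid_scheme \<Rightarrow> 'a set \<Rightarrow> ('g \<Rightarrow> 'a \<Rightarrow> 'a) \<Rightarrow> bool" where
  "isotypical G E \<phi> \<longleftrightarrow>
     (\<forall>X\<in>orbits G E \<phi>. \<forall>Y\<in>orbits G E \<phi>. isomorphic_orbits G \<phi> X Y)"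

text \<open>
  A contractible space is nonempty; the library's \<^const>\<open>contractible_space\<close> also holds of the
  empty space.
\<close>

definition nonempty_contractible_space :: "'x topology \<Rightarrow> bool" where
  "nonempty_contractible_space X \<longleftrightarrow> topspace X \<noteq> {} \<and> contractible_space X"

end

theory Submission
  imports Defs
begin

text \<open>
  Let \<open>Y\<close> be the union of all orbits of one isomorphism type; it is not all of \<open>E\<close>.  Let \<open>b\<close> be the
  invariant partition \<open>{Y, E - Y}\<close>.  If \<open>P\<close> is an invariant partition whose common refinement with \<open>b\<close>
  is discrete, then every block of \<open>P\<close> contains at most one point of \<open>Y\<close> and at most one point of
  \<open>E - Y\<close>.  Two points \<open>y\<close> and \<open>z\<close> forming such a block have the same stabilizer, namely that of the
  block, so their orbits are isomorphic, which is impossible; hence \<open>P\<close> is itself discrete.  Thus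
  \<open>P \<ge> P \<and> b \<le> b\<close> is a conical contraction of the poset of proper invariant partitions.

  A point fixed by the action has support a chain that is mapped to itself by every group element.
  A monotone bijection of a finite chain is the identity, so this support consists of invariant
  partitions.
\<close>

section \<open>Conical contractions of order complexes\<close>

text \<open>The complex is that of \<open>Q\<close>, but coordinates are indexed by the larger
  \<open>V\<close>, so that fixed points in a realization over \<open>V\<close> are literally points
  here. Reflexivity is asked only on \<open>Q\<close>, because \<open>refines\<close> is reflexive
  only on partitions.\<close>

locale conical_contraction =
  fixes r :: "'v \<Rightarrow> 'v \<Rightarrow> bool" and V Q :: "'v set" and m :: "'v \<Rightarrow> 'v" and b :: 'v
  assumes fin: "finite V" and QV: "Q \<subseteq> V"
    and refl: "\<And>x. x \<in> Q \<Longrightarrow> r x x"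
    and trans: "\<And>x y z. r x y \<Longrightarrow> r y z \<Longrightarrow> r x z"
    and antisym: "\<And>x y. r x y \<Longrightarrow> r y x \<Longrightarrow> x = y"
    and b: "b \<in> Q"
    and mQ: "\<And>x. x \<in> Q \<Longrightarrow> m x \<in> Q"
    and mono: "\<And>x y. x \<in> Q \<Longrightarrow> y \<in> Q \<Longrightarrow> r x y \<Longrightarrow> r (m x) (m y)"
    and m_le: "\<And>x. x \<in> Q \<Longrightarrow> r (m x) x"
    and m_le_b: "\<And>x. x \<in> Q \<Longrightarrow> r (m x) b"
begin

abbreviation points :: "('v \<Rightarrow> real) set" where
  "points \<equiv> realization_points V (order_complex r Q)"

abbreviation space :: "('v \<Rightarrow> real) topology" where
  "space \<equiv> subtopology (powertop_real V) points"

text \<open>Both homotopies have this form: \<open>u\<close> is the mass pushed forward along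
  \<open>m\<close>, \<open>w\<close> the mass left in place or already put on
  \<open>b\<close>.\<close>

definition mix :: "('v \<Rightarrow> real) \<Rightarrow> ('v \<Rightarrow> real) \<Rightarrow> 'v \<Rightarrow> real" where
  "mix w u = (\<lambda>v\<in>V. w v + (\<Sum>x\<in>{x \<in> Q. m x = v}. u x))"

text \<open>
  The straight line from \<open>t\<close> to its image under \<open>m\<close> leaves the complex, since \<open>x\<close> and \<open>m y\<close> need
  not be comparable when \<open>r x y\<close>.  The mass of \<open>t\<close> is therefore moved along \<open>m\<close> from the bottom of its
  support upwards: after time \<open>s\<close> exactly the lowest \<open>s\<close> units have moved, and the support
  \<open>m x\<^sub>0 \<le> \<dots> \<le> m x\<^sub>i \<le> x\<^sub>i \<le> \<dots> \<le> x\<^sub>k\<close> is still a chain.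
\<close>

definition below :: "('v \<Rightarrow> real) \<Rightarrow> 'v \<Rightarrow> real" where
  "below t v = (\<Sum>x\<in>{x \<in> V. r x v \<and> x \<noteq> v}. t x)"

definition moved :: "real \<Rightarrow> ('v \<Rightarrow> real) \<Rightarrow> 'v \<Rightarrow> real" where
  "moved s t v = min (t v) (max 0 (s - below t v))"

lemma finQ: "finite Q"
  using fin QV finite_subset by blast

lemma topspace_space: "topspace space = points"
  by (auto simp: realization_points_def topspace_product_topology PiE_def)

lemma pointsD:
  assumes "t \<in> points"
  shows "t \<in> extensional V" "\<And>v. v \<in> V \<Longrightarrow> 0 \<le> t v" "(\<Sum>v\<in>V. t v) = 1"
    "Complete_Partial_Order.chain r {v \<in> V. t v \<noteq> 0}"
    "\<And>v. v \<in> V \<Longrightarrow> t v \<noteq> 0 \<Longrightarrow> v \<in> Q"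
  using assms by (auto simp: realization_points_def order_complex_def)

lemma sum_Q:
  assumes "t \<in> points"
  shows "(\<Sum>v\<in>Q. t v) = 1"
proof -
  have "(\<Sum>v\<in>Q. t v) = (\<Sum>v\<in>V. t v)"
    by (rule sum.mono_neutral_left[OF fin QV]) (use pointsD(5)[OF assms] in auto)
  then show ?thesis
    using pointsD(3)[OF assms] by simp
qed

text \<open>Push-forward preserves total mass, and nonempty subsets of the chain \<open>S\<close>
  are simplices, so it suffices to locate both supports in \<open>S\<close>.\<close>

lemma mix_in_points:
  assumes w: "\<And>v. v \<in> V \<Longrightarrow> 0 \<le> w v" and u: "\<And>v. v \<in> Q \<Longrightarrow> 0 \<le> u v"
    and sum: "(\<Sum>v\<in>V. w v) + (\<Sum>v\<in>Q. u v) = 1"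
    and S: "S \<subseteq> Q" "Complete_Partial_Order.chain r S"
    and wS: "\<And>v. v \<in> V \<Longrightarrow> w v \<noteq> 0 \<Longrightarrow> v \<in> S"
    and uS: "\<And>v. v \<in> Q \<Longrightarrow> u v \<noteq> 0 \<Longrightarrow> m v \<in> S"
  shows "mix w u \<in> points"
proof -
  have "(\<Sum>v\<in>V. \<Sum>x\<in>{x \<in> Q. m x = v}. u x) = (\<Sum>v\<in>Q. u v)"
    by (rule sum.group[OF finQ fin]) (use mQ QV in auto)
  then have one: "(\<Sum>v\<in>V. mix w u v) = 1"
    using sum by (simp add: mix_def sum.distrib)
  have supp: "{v \<in> V. mix w u v \<noteq> 0} \<subseteq> S"
  proof clarify
    fix v assume v: "v \<in> V" "mix w u v \<noteq> 0"
    then have "w v \<noteq> 0 \<or> (\<Sum>x\<in>{x \<in> Q. m x = v}. u x) \<noteq> 0"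
      by (auto simp: mix_def)
    then show "v \<in> S"
    proof
      assume "(\<Sum>x\<in>{x \<in> Q. m x = v}. u x) \<noteq> 0"
      then obtain x where "x \<in> {x \<in> Q. m x = v}" "u x \<noteq> 0"
        by (meson sum.not_neutral_contains_not_neutral)
      then show "v \<in> S"
        using uS by auto
    qed (use wS v in auto)
  qed
  have "{v \<in> V. mix w u v \<noteq> 0} \<noteq> {}"
  proof
    assume "{v \<in> V. mix w u v \<noteq> 0} = {}"
    then have "(\<Sum>v\<in>V. mix w u v) = 0"
      by (intro sum.neutral) auto
    with one show False
      by simp
  qed
  then have "{v \<in> V. mix w u v \<noteq> 0} \<in> order_complex r Q"
    using supp S fin by (auto simp: order_complex_def Complete_Partial_Order.chain_def)
  moreover have "0 \<le> mix w u v" if "v \<in> V" for v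
    using that w u by (auto simp: mix_def intro!: add_nonneg_nonneg sum_nonneg)
  ultimately show ?thesis
    using one by (auto simp: realization_points_def) (simp add: mix_def)
qed

section \<open>How much mass has moved at time \<open>s\<close>\<close>

lemma below_nonneg: "t \<in> points \<Longrightarrow> 0 \<le> below t v"
  using pointsD(2) by (auto simp: below_def intro!: sum_nonneg)

lemma below_step:
  assumes t: "t \<in> points" and "x \<in> V" "r x y" "x \<noteq> y"
  shows "below t x + t x \<le> below t y"
proof -
  have "below t x + t x = (\<Sum>z\<in>insert x {z \<in> V. r z x \<and> z \<noteq> x}. t z)"
    using fin by (simp add: below_def)
  also have "\<dots> \<le> below t y"
    unfolding below_def
  proof (rule sum_mono2)
    show "insert x {z \<in> V. r z x \<and> z \<noteq> x} \<subseteq> {x \<in> V. r x y \<and> x \<noteq> y}"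
      using assms(2-4) by (blast intro: trans dest: antisym)
  qed (use fin pointsD(2)[OF t] in auto)
  finally show ?thesis .
qed

lemma below_le:
  assumes t: "t \<in> points" and "x \<in> V"
  shows "below t x + t x \<le> 1"
proof -
  have "below t x + t x = (\<Sum>z\<in>insert x {z \<in> V. r z x \<and> z \<noteq> x}. t z)"
    using fin by (simp add: below_def)
  also have "\<dots> \<le> (\<Sum>z\<in>V. t z)"
    by (rule sum_mono2) (use assms fin pointsD(2)[OF t] in auto)
  finally show ?thesis
    using pointsD(3)[OF t] by simp
qed

lemma moved_nonneg: "t \<in> points \<Longrightarrow> v \<in> V \<Longrightarrow> 0 \<le> moved s t v"
  using pointsD(2) by (auto simp: moved_def)

lemma moved_le: "moved s t v \<le> t v"
  by (simp add: moved_def)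

lemma moved_0: "t \<in> points \<Longrightarrow> v \<in> V \<Longrightarrow> moved 0 t v = 0"
  using pointsD(2) below_nonneg[of t v] by (auto simp: moved_def)

lemma moved_1: "t \<in> points \<Longrightarrow> v \<in> V \<Longrightarrow> moved 1 t v = t v"
  using below_le[of t v] by (auto simp: moved_def)

text \<open>Mass at \<open>y\<close> starts to move only after \<open>below t y\<close> units, and
  by then everything at the lower vertex \<open>x\<close> has moved.\<close>

lemma moved_before:
  assumes t: "t \<in> points" and "x \<in> V" "r x y" "x \<noteq> y" "moved s t y \<noteq> 0" "y \<in> V"
  shows "moved s t x = t x"
  using below_step[OF assms(1-4)] assms(5) pointsD(2)[OF t \<open>y \<in> V\<close>]
  by (auto simp: moved_def min_def max_def split: if_splits)

lemma mix_moved_in_points: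
  assumes t: "t \<in> points"
  shows "mix (\<lambda>v. t v - moved s t v) (moved s t) \<in> points"
proof -
  \<comment> \<open>\<open>A\<close> carries mass still in place, \<open>B\<close> mass that has
    moved; the vertex where the level \<open>s\<close> falls may lie in both.\<close>
  define A where "A = {v \<in> V. t v - moved s t v \<noteq> 0}"
  define B where "B = {v \<in> V. moved s t v \<noteq> 0}"
  have "t v \<noteq> 0" if "v \<in> A \<union> B" for v
    using that moved_nonneg[OF t, of v s] moved_le[of s t v] by (auto simp: A_def B_def)
  then have C: "A \<union> B \<subseteq> {v \<in> V. t v \<noteq> 0}"
    by (auto simp: A_def B_def)
  have CQ: "A \<union> B \<subseteq> Q"
    using C pointsD(5)[OF t] by auto
  have ch: "r x y \<or> r y x" if "x \<in> A \<union> B" "y \<in> A \<union> B" for x y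
    using Complete_Partial_Order.chainD[OF pointsD(4)[OF t]] that C by blast
  \<comment> \<open>Moved mass lies at or below unmoved mass: were \<open>y\<close> strictly below
    \<open>x\<close>, its mass would have moved completely.\<close>
  have BA: "r x y" if "x \<in> B" "y \<in> A" for x y
  proof (rule ccontr)
    assume "\<not> r x y"
    then have "r y x" "y \<noteq> x"
      using ch[of x y] that refl CQ by auto
    then have "moved s t y = t y"
      using moved_before[OF t, of y x s] that by (auto simp: A_def B_def)
    then show False
      using that by (auto simp: A_def)
  qed
  have mBA: "r (m x) y" if "x \<in> B" "y \<in> A" for x y
    using BA[OF that] m_le[of x] that CQ trans by blast
  have mBB: "r (m x) (m y) \<or> r (m y) (m x)" if "x \<in> B" "y \<in> B" for x y
    using ch[of x y] that CQ mono[of x y] mono[of y x] by auto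
  show ?thesis
  proof (rule mix_in_points[where S = "A \<union> m ` B"])
    show "A \<union> m ` B \<subseteq> Q"
      using CQ mQ by auto
    show "Complete_Partial_Order.chain r (A \<union> m ` B)"
      unfolding Complete_Partial_Order.chain_def using ch mBA mBB by blast
    have "(\<Sum>v\<in>Q. moved s t v) = (\<Sum>v\<in>V. moved s t v)"
      by (rule sum.mono_neutral_left[OF fin QV]) (use CQ in \<open>auto simp: B_def\<close>)
    then show "(\<Sum>v\<in>V. t v - moved s t v) + (\<Sum>v\<in>Q. moved s t v) = 1"
      using pointsD(3)[OF t] by (simp add: sum_subtractf)
  qed (use QV moved_nonneg[OF t] moved_le in \<open>auto simp: A_def B_def\<close>)
qed

text \<open>Here straight segments stay in the complex: \<open>b\<close> lies above every
  \<open>m x\<close>, so adding it to the image of a chain gives a chain.\<close>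

lemma mix_cone_in_points:
  assumes t: "t \<in> points" and s: "s \<in> {0..1}"
  shows "mix (\<lambda>v. if v = b then s else 0) (\<lambda>v. (1 - s) * t v) \<in> points"
proof (rule mix_in_points[where S = "insert b (m ` {v \<in> V. t v \<noteq> 0})"])
  show "insert b (m ` {v \<in> V. t v \<noteq> 0}) \<subseteq> Q"
    using b mQ pointsD(5)[OF t] by auto
  have mm: "r (m x) (m y) \<or> r (m y) (m x)" if "x \<in> V" "y \<in> V" "t x \<noteq> 0" "t y \<noteq> 0" for x y
    using pointsD(4,5)[OF t] that mono[of x y] mono[of y x]
    by (auto simp: Complete_Partial_Order.chain_def)
  show "Complete_Partial_Order.chain r (insert b (m ` {v \<in> V. t v \<noteq> 0}))"
    unfolding Complete_Partial_Order.chain_def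
    using mm refl[OF b] m_le_b pointsD(5)[OF t] by auto
  have "(\<Sum>v\<in>V. if v = b then s else 0) = s"
    using b QV fin by auto
  then show "(\<Sum>v\<in>V. if v = b then s else 0) + (\<Sum>v\<in>Q. (1 - s) * t v) = 1"
    using sum_Q[OF t] by (simp flip: sum_distrib_left)
qed (use s QV pointsD(2)[OF t] in \<open>auto split: if_splits\<close>)

section \<open>Continuity and the two homotopies\<close>

lemma continuous_map_mix:
  assumes "\<And>v. v \<in> V \<Longrightarrow> continuous_map X euclideanreal (\<lambda>p. w p v)"
    and "\<And>v. v \<in> V \<Longrightarrow> continuous_map X euclideanreal (\<lambda>p. u p v)"
    and "\<And>p. p \<in> topspace X \<Longrightarrow> mix (w p) (u p) \<in> points"
  shows "continuous_map X space (\<lambda>p. mix (w p) (u p))"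
proof -
  have "continuous_map X euclideanreal (\<lambda>p. mix (w p) (u p) v)" if "v \<in> V" for v
  proof -
    have "continuous_map X euclideanreal (\<lambda>p. w p v + (\<Sum>x\<in>{x \<in> Q. m x = v}. u p x))"
      by (intro continuous_intros) (use assms(1,2) that finQ QV in auto)
    then show ?thesis
      using that by (simp add: mix_def)
  qed
  then show ?thesis
    using assms(3)
    by (auto simp: continuous_map_in_subtopology continuous_map_componentwise mix_def)
qed

lemma continuous_map_coord:
  assumes "v \<in> V"
  shows "continuous_map (prod_topology (top_of_set {0..1::real}) space) euclideanreal (\<lambda>p. snd p v)"
proof -
  have "continuous_map space euclideanreal (\<lambda>t. t v)"
    using continuous_map_product_projection[OF assms]
    by (rule continuous_map_from_subtopology)
  then show ?thesis
    using continuous_map_compose[OF continuous_map_snd] by (fastforce simp: o_def)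
qed

lemma continuous_map_time:
  "continuous_map (prod_topology (top_of_set {0..1::real}) space) euclideanreal (\<lambda>p. fst p)"
  using continuous_map_fst[of "top_of_set {0..1::real}" space]
  by (simp add: continuous_map_in_subtopology)

lemma mix_cong:
  "(\<And>v. v \<in> V \<Longrightarrow> w v = w' v) \<Longrightarrow> (\<And>v. v \<in> V \<Longrightarrow> u v = u' v) \<Longrightarrow> mix w u = mix w' u'"
  using QV by (auto simp: mix_def fun_eq_iff intro!: sum.cong)

text \<open>First leg of the contraction. \<open>mix (\<lambda>_. 0)\<close> is the affine extension
  of \<open>m\<close>; \<open>moved\<close> is jointly continuous, being built from finite sums,
  \<open>min\<close> and \<open>max\<close>.\<close>

lemma homotopic_push:
  "homotopic_with (\<lambda>_. True) space space id (mix (\<lambda>_. 0))"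
proof (intro iffD2[OF homotopic_with] exI conjI ballI)
  let ?h = "\<lambda>p. mix (\<lambda>v. snd p v - moved (fst p) (snd p) v) (moved (fst p) (snd p))"
  have moved: "continuous_map (prod_topology (top_of_set {0..1::real}) space) euclideanreal
      (\<lambda>p. moved (fst p) (snd p) v)" if "v \<in> V" for v
    unfolding moved_def below_def
    by (intro continuous_intros continuous_map_coord continuous_map_time) (use that fin in auto)
  show "continuous_map (prod_topology (top_of_set {0..1}) space) space ?h"
  proof (rule continuous_map_mix)
    fix v assume "v \<in> V"
    then show "continuous_map (prod_topology (top_of_set {0..1::real}) space) euclideanreal
      (\<lambda>p. snd p v - moved (fst p) (snd p) v)"
      by (intro continuous_map_diff moved continuous_map_coord)
  next
    fix p assume "p \<in> topspace (prod_topology (top_of_set {0..1::real}) space)"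
    then show "?h p \<in> points"
      using mix_moved_in_points by (auto simp: topspace_space simp del: topspace_subtopology)
  qed (rule moved)
  show "?h (0, t) = id t" if "t \<in> topspace space" for t
  proof -
    have t: "t \<in> points"
      using that topspace_space by blast
    have "?h (0, t) = mix t (\<lambda>_. 0)"
      using moved_0[OF t] by (auto intro: mix_cong)
    also have "\<dots> = t"
      using pointsD(1)[OF t] by (auto simp: mix_def fun_eq_iff extensional_def)
    finally show ?thesis
      by simp
  qed
  show "?h (1, t) = mix (\<lambda>_. 0) t" if "t \<in> topspace space" for t
    using that topspace_space moved_1[of t] by (auto intro: mix_cong)
qed auto

text \<open>Second leg: the image under \<open>m\<close> is contracted linearly to the vertex
  \<open>b\<close>, a proportion \<open>fst p\<close> of the mass being transferred to
  \<open>b\<close>.\<close>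

lemma homotopic_cone:
  "homotopic_with (\<lambda>_. True) space space (mix (\<lambda>_. 0)) (\<lambda>_. \<lambda>v\<in>V. if v = b then 1 else 0)"
proof (intro iffD2[OF homotopic_with] exI conjI ballI)
  let ?h = "\<lambda>p. mix (\<lambda>v. if v = b then fst p else 0) (\<lambda>v. (1 - fst p) * snd p v)"
  show "continuous_map (prod_topology (top_of_set {0..1}) space) space ?h"
  proof (rule continuous_map_mix)
    fix v assume v: "v \<in> V"
    show "continuous_map (prod_topology (top_of_set {0..1::real}) space) euclideanreal
      (\<lambda>p. if v = b then fst p else 0)"
      using continuous_map_time by simp
    show "continuous_map (prod_topology (top_of_set {0..1::real}) space) euclideanreal
      (\<lambda>p. (1 - fst p) * snd p v)"
      by (intro continuous_intros continuous_map_coord continuous_map_time v) auto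
  next
    fix p assume "p \<in> topspace (prod_topology (top_of_set {0..1::real}) space)"
    then have "snd p \<in> points" "fst p \<in> {0..1}"
      by (auto simp: topspace_space simp del: topspace_subtopology)
    then show "?h p \<in> points"
      by (rule mix_cone_in_points)
  qed
qed (auto simp: mix_def intro: mix_cong)

lemma vertex_in_points: "(\<lambda>v\<in>V. if v = b then 1 else 0) \<in> points"
proof -
  have "{v \<in> V. v = b} = {b}" "(\<Sum>v\<in>V. if v = b then 1 else 0::real) = 1"
    using b QV fin by auto
  then show ?thesis
    using refl[OF b] b
    by (auto simp: realization_points_def order_complex_def Complete_Partial_Order.chain_def
        cong: conj_cong)
qed

theorem nonempty_contractible_points:
  "nonempty_contractible_space space"
  unfolding nonempty_contractible_space_def contractible_space_def topspace_space
  using homotopic_with_trans[OF homotopic_push homotopic_cone] vertex_in_points by blast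

end

section \<open>Invariant partitions\<close>

lemma isomorphic_orbits_refl: "isomorphic_orbits G \<phi> X X"
  unfolding isomorphic_orbits_def by (rule exI[of _ id]) auto

lemma isomorphic_orbits_trans:
  assumes "isomorphic_orbits G \<phi> X Y" "isomorphic_orbits G \<phi> Y Z"
  shows "isomorphic_orbits G \<phi> X Z"
proof -
  obtain f h where f: "bij_betw f X Y" "\<forall>g\<in>carrier G. \<forall>x\<in>X. f (\<phi> g x) = \<phi> g (f x)"
    and h: "bij_betw h Y Z" "\<forall>g\<in>carrier G. \<forall>y\<in>Y. h (\<phi> g y) = \<phi> g (h y)"
    using assms unfolding isomorphic_orbits_def by blast
  have "f x \<in> Y" if "x \<in> X" for x
    using f(1) that by (auto simp: bij_betw_def)
  then show ?thesis
    unfolding isomorphic_orbits_def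
    using bij_betw_trans[OF f(1) h(1)] f(2) h(2) by (intro exI[of _ "h \<circ> f"]) auto
qed

lemma partition_on_block_unique:
  "partition_on A P \<Longrightarrow> X \<in> P \<Longrightarrow> X' \<in> P \<Longrightarrow> x \<in> X \<Longrightarrow> x \<in> X' \<Longrightarrow> X = X'"
  unfolding partition_on_def disjoint_def by blast

text \<open>The block of the common refinement through \<open>x\<close> is an intersection of one
  block from each partition, and these must be the blocks through \<open>x\<close>.\<close>

lemma Int_in_common_refinement:
  assumes P: "partition_on A P" "partition_on A R"
    and X: "X \<in> P" "W \<in> R" "x \<in> X" "x \<in> W"
  shows "X \<inter> W \<in> common_refinement {P, R}"
proof -
  have cr: "partition_on A (common_refinement {P, R})"
    using P by (auto intro: partition_on_common_refinement)
  have "x \<in> A"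
    using P(1) X by (auto simp: partition_on_def)
  then obtain B where B: "B \<in> common_refinement {P, R}" "x \<in> B"
    using cr by (auto simp: partition_on_def)
  then obtain f where f: "f P \<in> P" "f R \<in> R" "B = f P \<inter> f R"
    by (auto simp: common_refinement)
  then have "f P = X" "f R = W"
    using partition_on_block_unique[OF P(1) f(1) X(1)] partition_on_block_unique[OF P(2) f(2) X(2)]
      X(3,4) B(2) by auto
  then show ?thesis
    using B f by simp
qed

section \<open>Orbits and stabilizers\<close>

context group_action
begin

lemma group_G: "group G"
  using group_hom by (rule group_hom.axioms)

lemma inv_carrier: "g \<in> carrier G \<Longrightarrow> inv g \<in> carrier G"
  using group_G by (rule group.inv_closed)

lemma action_inv: "g \<in> carrier G \<Longrightarrow> x \<in> E \<Longrightarrow> \<phi> (inv g) (\<phi> g x) = x"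
  using orbit_sym_aux by blast

text \<open>Which group elements agree at \<open>x\<close> is encoded in the stabilizer alone; this
  makes maps between orbits with equal stabilizers well defined and injective.\<close>

lemma eq_iff_stabilizer:
  assumes "g \<in> carrier G" "h \<in> carrier G" "x \<in> E"
  shows "\<phi> g x = \<phi> h x \<longleftrightarrow> inv h \<otimes> g \<in> stabilizer G \<phi> x"
proof -
  interpret group G by (rule group_G)
  have "\<phi> (inv h \<otimes> g) x = \<phi> (inv h) (\<phi> g x)"
    using assms by (simp add: composition_rule)
  moreover have "\<phi> (inv h) (\<phi> g x) = x \<longleftrightarrow> \<phi> g x = \<phi> h x"
    using assms action_inv[of h x] inj_prop[of "inv h"] element_image
    by (metis inj_onD inv_closed)
  ultimately show ?thesis
    using assms by (simp add: stabilizer_def)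
qed

lemma isomorphic_orbits_of_stabilizer_eq:
  assumes "x \<in> E" "y \<in> E" and stab: "stabilizer G \<phi> x = stabilizer G \<phi> y"
  shows "isomorphic_orbits G \<phi> (orbit G \<phi> x) (orbit G \<phi> y)"
proof -
  interpret group G by (rule group_G)
  \<comment> \<open>The intended map sends \<open>\<phi> g x\<close> to \<open>\<phi> g y\<close>;
    the chosen \<open>g\<close> is immaterial, by \<open>eq\<close> below.\<close>
  define f where "f w = \<phi> (SOME g. g \<in> carrier G \<and> \<phi> g x = w) y" for w
  have eq: "\<phi> g x = \<phi> h x \<longleftrightarrow> \<phi> g y = \<phi> h y" if "g \<in> carrier G" "h \<in> carrier G" for g h
    using eq_iff_stabilizer that assms by simp
  have f: "f (\<phi> g x) = \<phi> g y" if "g \<in> carrier G" for g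
  proof -
    let ?h = "SOME h. h \<in> carrier G \<and> \<phi> h x = \<phi> g x"
    have "?h \<in> carrier G \<and> \<phi> ?h x = \<phi> g x"
      by (rule someI[of _ g]) (use that in simp)
    then show ?thesis
      using eq that by (auto simp: f_def)
  qed
  have "f (\<phi> g w) = \<phi> g (f w)" if g: "g \<in> carrier G" and w: "w \<in> orbit G \<phi> x" for g w
  proof -
    obtain h where h: "h \<in> carrier G" "w = \<phi> h x"
      using w by (auto simp: orbit_def)
    then have "\<phi> g w = \<phi> (g \<otimes> h) x" "\<phi> g (f w) = \<phi> (g \<otimes> h) y"
      using that(1) assms f by (simp_all add: composition_rule)
    then show ?thesis
      using f that(1) h(1) by simp
  qed
  moreover have "inj_on f (orbit G \<phi> x)"
    using eq f by (auto simp: inj_on_def orbit_def)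
  moreover have "f ` orbit G \<phi> x = orbit G \<phi> y"
    using f by (force simp: orbit_def)
  ultimately show ?thesis
    unfolding isomorphic_orbits_def bij_betw_def by blast
qed

lemma orbit_action:
  assumes "g \<in> carrier G" "x \<in> E"
  shows "orbit G \<phi> (\<phi> g x) = orbit G \<phi> x"
proof -
  have "\<phi> g x \<in> E" "\<phi> g x \<in> orbit G \<phi> x"
    using assms element_image by (auto simp: orbit_def)
  then show ?thesis
    using disjoint_union[of "orbit G \<phi> (\<phi> g x)" "orbit G \<phi> x"] orbit_refl assms(2)
    by (auto simp: orbits_def)
qed

section \<open>The induced action on partitions\<close>

lemma partition_on_action:
  assumes "g \<in> carrier G" "partition_on E P"
  shows "partition_on E (partition_action \<phi> g P)"
proof -
  have "(`) (\<phi> g) ` P - {{}} = partition_action \<phi> g P"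
    using partition_onD3[OF assms(2)] by (auto simp: partition_action_def)
  then show ?thesis
    using partition_on_inj_image[OF assms(2) inj_prop[OF assms(1)]] surj_prop[OF assms(1)]
    by simp
qed

lemma refines_action:
  assumes "g \<in> carrier G" "refines E P P'"
  shows "refines E (partition_action \<phi> g P) (partition_action \<phi> g P')"
  using assms partition_on_action unfolding refines_def
  by (simp add: partition_action_def) (meson image_mono)

lemma partition_action_inv:
  assumes "g \<in> carrier G" "partition_on E P"
  shows "partition_action \<phi> (inv g) (partition_action \<phi> g P) = P"
proof -
  have "\<phi> (inv g) ` \<phi> g ` B = B" if "B \<in> P" for B
  proof -
    have "B \<subseteq> E"
      using that assms(2) by (auto simp: partition_on_def)
    then show ?thesis
      using action_inv[OF assms(1)] by (force simp: image_image)
  qed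
  then show ?thesis
    by (simp add: partition_action_def image_image)
qed

lemma partition_action_inv':
  assumes "g \<in> carrier G" "partition_on E P"
  shows "partition_action \<phi> g (partition_action \<phi> (inv g) P) = P"
  using partition_action_inv[OF inv_carrier[OF assms(1)] assms(2)]
    group.inv_inv[OF group_G assms(1)] by simp

lemma partition_action_top: "g \<in> carrier G \<Longrightarrow> partition_action \<phi> g {E} = {E}"
  using surj_prop by (simp add: partition_action_def)

lemma partition_action_bot:
  assumes "g \<in> carrier G"
  shows "partition_action \<phi> g ((\<lambda>x. {x}) ` E) = (\<lambda>x. {x}) ` E"
proof -
  have "partition_action \<phi> g ((\<lambda>x. {x}) ` E) = (\<lambda>x. {x}) ` \<phi> g ` E"
    by (simp add: partition_action_def image_image)
  then show ?thesis
    using surj_prop[OF assms] by simp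
qed

lemma proper_partitions_action:
  assumes g: "g \<in> carrier G" and P: "P \<in> proper_partitions E"
  shows "partition_action \<phi> g P \<in> proper_partitions E"
proof -
  have "partition_on E P"
    using P by (simp add: proper_partitions_def)
  \<comment> \<open>The inverse fixes both trivial partitions, so \<open>P\<close> would be trivial
    if its image were.\<close>
  then have "P = partition_action \<phi> (inv g) (partition_action \<phi> g P)"
    using partition_action_inv[OF g] by simp
  then show ?thesis
    using P partition_on_action[OF g, of P] partition_action_top[of "inv g"]
      partition_action_bot[of "inv g"] inv_carrier[OF g]
    by (auto simp: proper_partitions_def)
qed

definition
  "invariant_partitions =
     {P \<in> proper_partitions E. \<forall>g\<in>carrier G. partition_action \<phi> g P = P}"

text \<open>Common refinement is the meet for \<open>refines\<close>, and group elements act by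
  order automorphisms fixing \<open>P\<close> and \<open>R\<close>.\<close>

lemma common_refinement_invariant:
  assumes P: "partition_on E P" "partition_on E R"
    and inv: "\<And>g. g \<in> carrier G \<Longrightarrow> partition_action \<phi> g P = P"
      "\<And>g. g \<in> carrier G \<Longrightarrow> partition_action \<phi> g R = R"
    and g: "g \<in> carrier G"
  shows "partition_action \<phi> g (common_refinement {P, R}) = common_refinement {P, R}"
proof -
  let ?M = "common_refinement {P, R}"
  have M: "partition_on E ?M" "refines E ?M P" "refines E ?M R"
    using P by (auto intro: partition_on_common_refinement refines_common_refinement)
  have le: "refines E (partition_action \<phi> h ?M) ?M" if h: "h \<in> carrier G" for h
  proof (rule common_refinement_coarsest)
    fix S assume "S \<in> {P, R}"
    then show "refines E (partition_action \<phi> h ?M) S"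
      using refines_action[OF h M(2)] refines_action[OF h M(3)] inv h by auto
  qed (use P partition_on_action[OF h M(1)] in auto)
  \<comment> \<open>The reverse comparison comes from applying \<open>g\<close> to \<open>le\<close>
    for \<open>inv g\<close>.\<close>
  have "refines E ?M (partition_action \<phi> g ?M)"
    using refines_action[OF g le[OF inv_carrier[OF g]]] partition_action_inv'[OF g M(1)] by simp
  with le[OF g] show ?thesis
    by (rule refines_asym)
qed

text \<open>The image of \<open>B\<close> is again a block and shares the fixed point
  \<open>y\<close> with \<open>B\<close>.\<close>

lemma block_stabilized:
  assumes P: "partition_on E P" "\<And>g. g \<in> carrier G \<Longrightarrow> partition_action \<phi> g P = P"
    and "B \<in> P" "y \<in> B" "g \<in> carrier G" "\<phi> g y = y"
  shows "\<phi> g ` B = B"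
proof -
  have "\<phi> g ` B \<in> P"
    using P(2)[of g] assms by (auto simp: partition_action_def)
  moreover have "y \<in> \<phi> g ` B"
    using assms by force
  ultimately show ?thesis
    using partition_on_block_unique[OF P(1)] assms(3,4) by blast
qed

end

text \<open>What the argument uses of the union of all orbits of one isomorphism type: an invariant
  proper part whose stabilizers do not occur outside it.\<close>

locale stabilizer_separation = group_action +
  fixes Y
  assumes Y: "Y \<subseteq> E" "Y \<noteq> {}" "Y \<noteq> E"
    and Y_action: "\<And>g y. g \<in> carrier G \<Longrightarrow> y \<in> E \<Longrightarrow> \<phi> g y \<in> Y \<longleftrightarrow> y \<in> Y"
    and stabilizer_neq: "\<And>y z. y \<in> Y \<Longrightarrow> z \<in> E - Y \<Longrightarrow> stabilizer G \<phi> y \<noteq> stabilizer G \<phi> z"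
begin

lemma partition_split: "partition_on E {Y, E - Y}"
  using Y by (auto simp: partition_on_def disjoint_def)

lemma split_invariant:
  assumes g: "g \<in> carrier G"
  shows "partition_action \<phi> g {Y, E - Y} = {Y, E - Y}"
proof -
  have "\<phi> g ` Y = Y"
  proof
    show "Y \<subseteq> \<phi> g ` Y"
    proof
      fix y assume "y \<in> Y"
      moreover then obtain x where "x \<in> E" "y = \<phi> g x"
        using Y(1) surj_prop[OF g] by blast
      ultimately show "y \<in> \<phi> g ` Y"
        using Y_action[OF g] by auto
    qed
  qed (use Y_action[OF g] Y(1) in auto)
  moreover have "\<phi> g ` (E - Y) = \<phi> g ` E - \<phi> g ` Y"
    by (rule inj_on_image_set_diff[OF inj_prop[OF g]]) (use Y in auto)
  ultimately show ?thesis
    using surj_prop[OF g] by (simp add: partition_action_def)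
qed

text \<open>Keeps the meet with the split away from the bottom; equality of stabilizers is what
  excludes a two-point block.\<close>

lemma common_refinement_split_neq_singletons:
  assumes P: "partition_on E P" "\<And>g. g \<in> carrier G \<Longrightarrow> partition_action \<phi> g P = P"
    and neq: "P \<noteq> (\<lambda>x. {x}) ` E"
  shows "common_refinement {P, {Y, E - Y}} \<noteq> (\<lambda>x. {x}) ` E"
proof
  assume cr: "common_refinement {P, {Y, E - Y}} = (\<lambda>x. {x}) ` E"
  \<comment> \<open>Two points of a block on the same side lie in one block of the meet, which is a
    singleton.\<close>
  have single: "x = x'" if "B \<in> P" "x \<in> B" "x' \<in> B" "x \<in> Y \<longleftrightarrow> x' \<in> Y" for B x x'
  proof -
    let ?W = "if x \<in> Y then Y else E - Y"
    have "B \<subseteq> E"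
      using P(1) that(1) by (auto simp: partition_on_def)
    then have W: "?W \<in> {Y, E - Y}" "x \<in> ?W" "x' \<in> ?W"
      using that by auto
    then have "B \<inter> ?W \<in> (\<lambda>x. {x}) ` E"
      using Int_in_common_refinement[OF P(1) partition_split that(1) W(1) that(2)] cr by simp
    moreover have "x \<in> B \<inter> ?W" "x' \<in> B \<inter> ?W"
      using W that by auto
    ultimately show "x = x'"
      by (metis (no_types, lifting) imageE singletonD)
  qed
  have separated: "y \<in> Y \<longleftrightarrow> z \<in> Y" if "B \<in> P" "y \<in> B" "z \<in> B" for B y z
  proof -
    have BE: "B \<subseteq> E"
      using P(1) that(1) by (auto simp: partition_on_def)
    \<comment> \<open>If \<open>g\<close> fixes a point of \<open>B\<close>, it preserves
      \<open>B\<close> and both sides, so \<open>single\<close> identifies \<open>\<phi> g w\<close>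
      with \<open>w\<close>. Hence all points of \<open>B\<close> have the same stabilizer.\<close>
    have fixes_all: "\<phi> g w = w" if "g \<in> carrier G" "u \<in> B" "w \<in> B" "\<phi> g u = u" for g u w
    proof -
      have "\<phi> g w \<in> B"
        using block_stabilized[OF P \<open>B \<in> P\<close> that(2,1,4)] that(3) by auto
      then show ?thesis
        using single[OF \<open>B \<in> P\<close>, of "\<phi> g w" w] Y_action that BE by blast
    qed
    then have "stabilizer G \<phi> y = stabilizer G \<phi> z"
      using that unfolding stabilizer_def by blast
    then show ?thesis
      using stabilizer_neq[of y z] stabilizer_neq[of z y] that BE by auto
  qed
  \<comment> \<open>\<open>separated\<close> puts all points of a block on one side, so
    \<open>single\<close> makes every block a singleton.\<close>
  have "refines E P ((\<lambda>x. {x}) ` E)"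
    unfolding refines_def
  proof (intro conjI ballI)
    fix B assume B: "B \<in> P"
    then obtain x where "x \<in> B"
      using partition_onD3[OF P(1)] by fastforce
    then have "x \<in> E"
      using B partition_onD1[OF P(1)] by blast
    then show "\<exists>W\<in>(\<lambda>x. {x}) ` E. B \<subseteq> W"
      using single[OF B \<open>x \<in> B\<close>] separated[OF B \<open>x \<in> B\<close>] by blast
  qed (use P(1) partition_on_singletons in auto)
  moreover have "refines E ((\<lambda>x. {x}) ` E) P"
    using P(1) partition_on_singletons[of E] by (auto simp: refines_def partition_on_def)
  ultimately show False
    using neq refines_asym by blast
qed

lemma split_mem: "{Y, E - Y} \<in> invariant_partitions"
proof -
  let ?b = "{Y, E - Y}"
  obtain y z where yz: "y \<in> Y" "z \<in> E" "z \<notin> Y"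
    using Y by blast
  have E: "partition_on E {E}"
    using yz by (auto intro: partition_on_space)
  \<comment> \<open>The meet of the top \<open>{E}\<close> with \<open>?b\<close> is
    \<open>?b\<close>. The previous lemma, applied to \<open>{E}\<close>, then excludes that both
    parts of the split are single points.\<close>
  have "refines E (common_refinement {{E}, ?b}) ?b"
    using E partition_split by (auto intro: refines_common_refinement)
  moreover have "refines E ?b (common_refinement {{E}, ?b})"
  proof (rule common_refinement_coarsest)
    fix S assume "S \<in> {{E}, ?b}"
    then show "refines E ?b S"
      using E partition_split Y(1) by (auto simp: refines_def)
  qed (use E partition_split in auto)
  ultimately have "common_refinement {{E}, ?b} = ?b"
    by (rule refines_asym)
  moreover have "{y} \<in> (\<lambda>x. {x}) ` E" "{y} \<noteq> E"
    using yz Y(1) by auto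
  then have "{E} \<noteq> (\<lambda>x. {x}) ` E"
    by auto
  ultimately have "?b \<noteq> (\<lambda>x. {x}) ` E"
    using common_refinement_split_neq_singletons[OF E partition_action_top] by simp
  moreover have "?b \<noteq> {E}"
    using Y by auto
  ultimately show ?thesis
    using split_invariant partition_split by (simp add: invariant_partitions_def proper_partitions_def)
qed

lemma common_refinement_split_mem:
  assumes "P \<in> invariant_partitions"
  shows "common_refinement {P, {Y, E - Y}} \<in> invariant_partitions"
proof -
  let ?b = "{Y, E - Y}"
  have P: "partition_on E P" "\<And>g. g \<in> carrier G \<Longrightarrow> partition_action \<phi> g P = P" "P \<noteq> (\<lambda>x. {x}) ` E"
    using assms by (auto simp: invariant_partitions_def proper_partitions_def)
  have M: "refines E (common_refinement {P, ?b}) ?b" "partition_on E (common_refinement {P, ?b})"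
    using P partition_split by (auto intro: refines_common_refinement partition_on_common_refinement)
  \<comment> \<open>\<open>E\<close> is contained in neither \<open>Y\<close> nor its
    complement.\<close>
  have "common_refinement {P, ?b} \<noteq> {E}"
    using M(1) Y by (auto simp: refines_def)
  then show ?thesis
    using M common_refinement_split_neq_singletons[OF P]
      common_refinement_invariant[OF P(1) partition_split P(2) split_invariant]
    by (simp add: invariant_partitions_def proper_partitions_def)
qed

end

section \<open>Fixed points of the realization\<close>

text \<open>An injective monotone map cannot lower the number \<open>card (D y)\<close> of elements
  below, and permuting \<open>C\<close> preserves the sum of these numbers, so each element keeps
  its rank; in a chain the rank determines the element.\<close>

lemma inj_mono_on_finite_chain_fixes:
  assumes "finite C" "Complete_Partial_Order.chain r C" "f ` C \<subseteq> C" "inj_on f C"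
    and refl: "\<And>x. x \<in> C \<Longrightarrow> r x x"
    and trans: "\<And>x y z. r x y \<Longrightarrow> r y z \<Longrightarrow> r x z"
    and antisym: "\<And>x y. r x y \<Longrightarrow> r y x \<Longrightarrow> x = y"
    and mono: "\<And>x y. r x y \<Longrightarrow> r (f x) (f y)"
    and "x \<in> C"
  shows "f x = x"
proof -
  define D where "D x = {y \<in> C. r y x}" for x
  have fC: "f ` C = C"
    using assms(1,3,4) by (simp add: endo_inj_surj)
  have finD: "finite (D y)" for y
    using assms(1) by (simp add: D_def)
  have le: "card (D y) \<le> card (D (f y))" if "y \<in> C" for y
  proof (rule card_inj_on_le[of f])
    show "inj_on f (D y)"
      using assms(4) by (rule inj_on_subset) (auto simp: D_def)
    show "f ` D y \<subseteq> D (f y)"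
      using assms(3) mono by (auto simp: D_def)
  qed (rule finD)
  have "(\<Sum>y\<in>C. card (D (f y))) = (\<Sum>y\<in>C. card (D y))"
    using sum.reindex[OF assms(4), of "\<lambda>y. card (D y)"] fC by simp
  then have eq: "card (D x) = card (D (f x))"
    using sum_mono_inv[of "\<lambda>y. card (D y)" C "\<lambda>y. card (D (f y))" x] le assms(1) \<open>x \<in> C\<close> by simp
  have fx: "f x \<in> C"
    using assms(3) \<open>x \<in> C\<close> by auto
  have "r x (f x) \<or> r (f x) x"
    using assms(2) fx \<open>x \<in> C\<close> by (auto simp: Complete_Partial_Order.chain_def)
  \<comment> \<open>Down-sets of comparable elements are nested, so equal cardinality makes them
    equal.\<close>
  then have "D x \<subseteq> D (f x) \<or> D (f x) \<subseteq> D x"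
    unfolding D_def using trans by blast
  then have "D x = D (f x)"
    using eq finD by (metis card_subset_eq)
  moreover have "x \<in> D x" "f x \<in> D (f x)"
    using refl fx \<open>x \<in> C\<close> by (auto simp: D_def)
  ultimately show ?thesis
    using antisym unfolding D_def by blast
qed

context group_action
begin

text \<open>Forward, the support is a finite chain permuted by the group, hence fixed pointwise;
  conversely, nonzero coordinates occur only at invariant partitions. Indexing by all proper
  partitions on both sides makes this an equality of sets of functions.\<close>

lemma proper_partitions_fixed_iff:
  assumes "finite E"
    and t: "t \<in> realization_points (proper_partitions E)
        (order_complex (refines E) (proper_partitions E))"
  shows "(\<forall>g\<in>carrier G.
        realization_action G (proper_partitions E) (partition_action \<phi>) g t = t) \<longleftrightarrow>
      t \<in> realization_points (proper_partitions E) (order_complex (refines E) invariant_partitions)"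
    (is "?fixed \<longleftrightarrow> _")
proof -
  define V where "V = proper_partitions E"
  define C where "C = {P \<in> V. t P \<noteq> 0}"
  have on: "partition_on E P" if "P \<in> V" for P
    using that by (simp add: V_def proper_partitions_def)
  have C: "finite C" "C \<noteq> {}" "Complete_Partial_Order.chain (refines E) C"
    using t by (auto simp: realization_points_def order_complex_def C_def V_def)
  have iff: "t \<in> realization_points V (order_complex (refines E) invariant_partitions) \<longleftrightarrow>
      C \<subseteq> invariant_partitions"
    using t C by (auto simp: realization_points_def order_complex_def C_def V_def)
  have "C \<subseteq> invariant_partitions" if ?fixed
  proof
    fix P assume P: "P \<in> C"
    have "partition_action \<phi> g P = P" if g: "g \<in> carrier G" for g
    proof (rule inj_mono_on_finite_chain_fixes[where r = "refines E" and C = C])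
      show "partition_action \<phi> g ` C \<subseteq> C"
      proof clarify
        fix P assume P: "P \<in> C"
        then have "partition_action \<phi> g P \<in> V"
          using proper_partitions_action[OF g] by (simp add: C_def V_def)
        \<comment> \<open>The moved point has at the moved vertex the old coordinate at
          \<open>P\<close>, so the support of a fixed point is preserved.\<close>
        then have "realization_action G V (partition_action \<phi>) g t (partition_action \<phi> g P) = t P"
          using P on[of P] partition_action_inv[OF g] by (simp add: realization_action_def C_def)
        then show "partition_action \<phi> g P \<in> C"
          using \<open>?fixed\<close> g P \<open>partition_action \<phi> g P \<in> V\<close> by (simp add: C_def V_def)
      qed
      show "inj_on (partition_action \<phi> g) C"
        by (rule inj_on_inverseI[where g = "partition_action \<phi> (inv g)"])
          (use partition_action_inv[OF g] on C_def in auto)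
      show "refines E P R" if "refines E P S" "refines E S R" for P S R
        using that by (rule refines_trans)
      show "P = R" if "refines E P R" "refines E R P" for P R
        using that by (rule refines_asym)
    qed (use C P on refines_refl refines_action[OF g] in \<open>auto simp: C_def\<close>)
    then show "P \<in> invariant_partitions"
      using P by (simp add: invariant_partitions_def C_def V_def)
  qed
  moreover have ?fixed if sub: "C \<subseteq> invariant_partitions"
  proof
    fix g assume g: "g \<in> carrier G"
    have "t (partition_action \<phi> (inv g) P) = t P" if P: "P \<in> V" for P
    proof (cases "P \<in> invariant_partitions")
      case True
      then show ?thesis
        using inv_carrier[OF g] by (simp add: invariant_partitions_def)
    next
      case False
      let ?P = "partition_action \<phi> (inv g) P"
      have "?P \<in> V"
        using proper_partitions_action[OF inv_carrier[OF g]] P by (simp add: V_def)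
      moreover have "partition_action \<phi> g ?P = P"
        using partition_action_inv'[OF g on[OF P]] .
      \<comment> \<open>If \<open>?P\<close> were invariant, its image \<open>P\<close> under
        \<open>g\<close> would equal it and be invariant too.\<close>
      then have "?P \<notin> invariant_partitions"
        using False g P by (auto simp: invariant_partitions_def V_def)
      ultimately have "t ?P = 0" "t P = 0"
        using sub False P unfolding C_def by blast+
      then show ?thesis
        by simp
    qed
    moreover have "t \<in> extensional V"
      using t by (simp add: realization_points_def V_def)
    ultimately show "realization_action G (proper_partitions E) (partition_action \<phi>) g t = t"
      by (auto simp: realization_action_def V_def fun_eq_iff extensional_def)
  qed
  ultimately show ?thesis
    using iff by (auto simp: V_def)
qed

end

section \<open>The contraction for a non-isotypical action\<close>

lemma (in stabilizer_separation) conical_contraction_invariant_partitions: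
  assumes "finite E"
  shows "conical_contraction (refines E) (proper_partitions E) invariant_partitions
    (\<lambda>P. common_refinement {P, {Y, E - Y}}) {Y, E - Y}"
proof
  have on: "partition_on E P" if "P \<in> invariant_partitions" for P
    using that by (simp add: invariant_partitions_def proper_partitions_def)
  have le: "refines E (common_refinement {P, {Y, E - Y}}) P"
    "refines E (common_refinement {P, {Y, E - Y}}) {Y, E - Y}" if "P \<in> invariant_partitions" for P
    using on[OF that] partition_split by (auto intro: refines_common_refinement)
  show "finite (proper_partitions E)"
    using finitely_many_partition_on[OF assms]
    by (rule rev_finite_subset) (auto simp: proper_partitions_def)
  show "invariant_partitions \<subseteq> proper_partitions E"
    by (auto simp: invariant_partitions_def)
  show "refines E P P" if "P \<in> invariant_partitions" for P
    using on[OF that] by (rule refines_refl)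
  show "refines E P R" if "refines E P S" "refines E S R" for P S R
    using that by (rule refines_trans)
  show "P = R" if "refines E P R" "refines E R P" for P R
    using that by (rule refines_asym)
  show "refines E (common_refinement {P, {Y, E - Y}}) (common_refinement {R, {Y, E - Y}})"
    if "P \<in> invariant_partitions" "R \<in> invariant_partitions" "refines E P R" for P R
  \<comment> \<open>The meet of \<open>P\<close> with the split lies below the split and below
    \<open>P\<close>, hence below \<open>R\<close>, so it lies below their meet.\<close>
  proof (rule common_refinement_coarsest)
    show "partition_on E (common_refinement {P, {Y, E - Y}})"
      using le(1)[OF that(1)] by (simp add: refines_def)
    fix S assume "S \<in> {R, {Y, E - Y}}"
    then show "partition_on E S" "refines E (common_refinement {P, {Y, E - Y}}) S"
      using on[OF that(2)] partition_split le[OF that(1)] that(3) refines_trans by blast+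
  qed auto
qed (use split_mem common_refinement_split_mem partition_split in
    \<open>auto simp: invariant_partitions_def proper_partitions_def intro: refines_common_refinement\<close>)

lemma (in group_action) stabilizer_separation_if_not_isotypical:
  assumes "\<not> isotypical G E \<phi>"
  obtains Y where "stabilizer_separation G E \<phi> Y"
proof -
  obtain a b where ab: "a \<in> E" "b \<in> E" "\<not> isomorphic_orbits G \<phi> (orbit G \<phi> a) (orbit G \<phi> b)"
    using assms by (auto simp: isotypical_def orbits_def)
  \<comment> \<open>\<open>b\<close> shows that \<open>Y\<close> is nonempty, \<open>a\<close> that
    it is not all of \<open>E\<close>.\<close>
  define Y where "Y = {x \<in> E. isomorphic_orbits G \<phi> (orbit G \<phi> x) (orbit G \<phi> b)}"
  have "stabilizer_separation G E \<phi> Y"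
  proof
    show "Y \<subseteq> E" "Y \<noteq> {}" "Y \<noteq> E"
      using ab isomorphic_orbits_refl by (auto simp: Y_def)
    show "\<phi> g y \<in> Y \<longleftrightarrow> y \<in> Y" if "g \<in> carrier G" "y \<in> E" for g y
      using that orbit_action element_image by (simp add: Y_def)
    \<comment> \<open>Equal stabilizers would give an isomorphism from the orbit of \<open>z\<close>
      to that of \<open>y\<close>, and transitivity would put \<open>z\<close> into
      \<open>Y\<close>.\<close>
    show "stabilizer G \<phi> y \<noteq> stabilizer G \<phi> z" if "y \<in> Y" "z \<in> E - Y" for y z
      using that isomorphic_orbits_of_stabilizer_eq[of z y] isomorphic_orbits_trans
      unfolding Y_def by blast
  qed
  then show thesis
    by (rule that)
qed

theorem lemma1p6:
  fixes G :: "('g, 'm) monoid_scheme" and n :: nat and \<phi> :: "'g \<Rightarrow> nat \<Rightarrow> nat"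
  assumes "n \<ge> 2"
    and "group_action G {1..n} \<phi>"
    and "\<not> isotypical G {1..n} \<phi>"
  shows "nonempty_contractible_space (partition_complex_fixed_points G n \<phi>)"
proof -
  interpret group_action G "{1..n}" \<phi>
    by (rule assms(2))
  obtain Y where "stabilizer_separation G {1..n} \<phi> Y"
    using stabilizer_separation_if_not_isotypical[OF assms(3)] .
  then interpret stabilizer_separation G "{1..n}" \<phi> Y .
  let ?V = "proper_partitions {1..n}"
  let ?X = "realization_points ?V (order_complex (refines {1..n}) ?V)"
  let ?F = "realization_points ?V (order_complex (refines {1..n}) invariant_partitions)"
  interpret conical_contraction "refines {1..n}" ?V invariant_partitions
    "\<lambda>P. common_refinement {P, {Y, {1..n} - Y}}" "{Y, {1..n} - Y}"
    by (rule conical_contraction_invariant_partitions) simp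
  have "topspace (partition_complex n) = ?X"
    by (auto simp: partition_complex_def geometric_realization_def realization_points_def PiE_def)
  moreover have "?F \<subseteq> ?X"
    by (auto simp: realization_points_def order_complex_def invariant_partitions_def)
  ultimately have "?X \<inter> {t \<in> topspace (partition_complex n). \<forall>g\<in>carrier G.
      realization_action G ?V (partition_action \<phi>) g t = t} = ?F"
    using proper_partitions_fixed_iff by auto
  \<comment> \<open>Both sides are subspaces of the same product of lines, so equal underlying sets
    give equal topologies.\<close>
  then have "partition_complex_fixed_points G n \<phi> = space"
    by (simp add: partition_complex_fixed_points_def fixed_point_space_def partition_complex_def
        geometric_realization_def subtopology_subtopology)
  then show ?thesis
    using nonempty_contractible_points by simp
qed

end
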